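(* Let $S$ be a digital circle, i.e. a digital $1$-sphere. Then $S$ does not admit a multiplication with two-sided unit; that is, there do not exist a continuous map $m\colon S\times S\to S$ and a point $s_0\in S$ such that $m(x,s_0)=x=m(s_0,x)$ for all $x\in S$.
   Context: A (finite) tolerance space is a finite set $X$ with a symmetric, reflexive relation $\sim$ (adjacency); it is identified with the finite simple graph whose edges join distinct adjacent points. A map $f\colon X\to Y$ is continuous if $x\sim x'$ implies $f(x)\sim f(x')$. The product $X\times Y$ has $(x,y)\sim(x',y')$ iff $x\sim x'$ and $y\sim y'$. For a vertex $v$ of a graph $G$, the link $\mathrm{lk}_G(v)$ is the induced subgraph on the neighbors of $v$ (excluding $v$). The simple digitally contractible finite tolerance spaces form the smallest class (closed under isomorphism) containing the one-point space and closed under the following transformations: deleting a simple vertex (a vertex $v$ whose link is simple digitally contractible) together with its incident edges; attaching a new vertex with incident edges so that it is simple; deleting a simple edge $uw$ (an edge for which the induced subgraph on $\mathrm{lk}_G(u)\cap\mathrm{lk}_G(w)$ is simple digitally contractible); attaching an edge between two non-adjacent vertices so that it is simple. The empty space is not simple digitally contractible. A digital $0$-sphere is a tolerance space consisting of two disconnected (non-adjacent) points. A digital $1$-sphere is a connected graph $S$ such that for every $v\in S$ the link $\mathrm{lk}_S(v)$ is a digital $0$-sphere and $S-v$ is simple digitally contractible. *)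

theory Defs
  imports "HOL-Library.FuncSet"
begin

text \<open>Adjacency is stored as a reflexive relation on the points, so the edges of the associated
  simple graph are the off-diagonal pairs.\<close>

record 'a tolspace =
  points :: "'a set"
  adj :: "'a rel"

definition tolerance_space :: "'a tolspace \<Rightarrow> bool" where
  "tolerance_space X \<longleftrightarrow> finite (points X) \<and> adj X \<subseteq> points X \<times> points X \<and>
     refl_on (points X) (adj X) \<and> sym (adj X)"

definition tol_continuous :: "'a tolspace \<Rightarrow> 'b tolspace \<Rightarrow> ('a \<Rightarrow> 'b) \<Rightarrow> bool" where
  "tol_continuous X Y f \<longleftrightarrow> f \<in> points X \<rightarrow> points Y \<and>
     (\<forall>x\<in>points X. \<forall>x'\<in>points X. (x, x') \<in> adj X \<longrightarrow> (f x, f x') \<in> adj Y)"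

definition tol_prod :: "'a tolspace \<Rightarrow> 'b tolspace \<Rightarrow> ('a \<times> 'b) tolspace" where
  "tol_prod X Y = \<lparr>points = points X \<times> points Y,
     adj = {((x, y), (x', y')). (x, x') \<in> adj X \<and> (y, y') \<in> adj Y}\<rparr>"

definition tol_iso :: "'a tolspace \<Rightarrow> 'b tolspace \<Rightarrow> bool" where
  "tol_iso X Y \<longleftrightarrow> (\<exists>f. bij_betw f (points X) (points Y) \<and>
     (\<forall>x\<in>points X. \<forall>x'\<in>points X. (x, x') \<in> adj X \<longleftrightarrow> (f x, f x') \<in> adj Y))"

definition connected_tolspace :: "'a tolspace \<Rightarrow> bool" where
  "connected_tolspace X \<longleftrightarrow> points X \<noteq> {} \<and> (\<forall>x\<in>points X. \<forall>y\<in>points X. (x, y) \<in> (adj X)\<^sup>*)"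

definition induced :: "'a tolspace \<Rightarrow> 'a set \<Rightarrow> 'a tolspace" where
  "induced X A = \<lparr>points = points X \<inter> A, adj = adj X \<inter> A \<times> A\<rparr>"

definition neighbors :: "'a tolspace \<Rightarrow> 'a \<Rightarrow> 'a set" where
  "neighbors X v = {w \<in> points X. (v, w) \<in> adj X \<and> w \<noteq> v}"

definition link :: "'a tolspace \<Rightarrow> 'a \<Rightarrow> 'a tolspace" where
  "link X v = induced X (neighbors X v)"

definition edge_link :: "'a tolspace \<Rightarrow> 'a \<Rightarrow> 'a \<Rightarrow> 'a tolspace" where
  "edge_link X u w = induced X (neighbors X u \<inter> neighbors X w)"

definition one_point :: "'a \<Rightarrow> 'a tolspace" where
  "one_point v = \<lparr>points = {v}, adj = {(v, v)}\<rparr>"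

definition delete_vertex :: "'a tolspace \<Rightarrow> 'a \<Rightarrow> 'a tolspace" where
  "delete_vertex X v = induced X (points X - {v})"

definition attach_vertex :: "'a tolspace \<Rightarrow> 'a \<Rightarrow> 'a set \<Rightarrow> 'a tolspace" where
  "attach_vertex X v A = \<lparr>points = insert v (points X),
     adj = adj X \<union> {(v, v)} \<union> {v} \<times> A \<union> A \<times> {v}\<rparr>"

definition delete_edge :: "'a tolspace \<Rightarrow> 'a \<Rightarrow> 'a \<Rightarrow> 'a tolspace" where
  "delete_edge X u w = \<lparr>points = points X, adj = adj X - {(u, w), (w, u)}\<rparr>"

definition attach_edge :: "'a tolspace \<Rightarrow> 'a \<Rightarrow> 'a \<Rightarrow> 'a tolspace" where
  "attach_edge X u w = \<lparr>points = points X, adj = adj X \<union> {(u, w), (w, u)}\<rparr>"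

text \<open>Attaching a vertex needs a fresh point, and intermediate spaces may be larger than the
  space one ends up with. The class is therefore generated inside the infinite type of natural
  numbers, which contains a copy of every finite tolerance space, and then closed under
  isomorphism to arbitrary point types.\<close>

inductive nat_simple_contractible :: "nat tolspace \<Rightarrow> bool" where
  point: "nat_simple_contractible (one_point v)"
| iso: "nat_simple_contractible X \<Longrightarrow> tolerance_space Y \<Longrightarrow> tol_iso X Y
    \<Longrightarrow> nat_simple_contractible Y"
| delete_vertex: "nat_simple_contractible X \<Longrightarrow> v \<in> points X
    \<Longrightarrow> nat_simple_contractible (link X v) \<Longrightarrow> nat_simple_contractible (delete_vertex X v)"
| attach_vertex: "nat_simple_contractible X \<Longrightarrow> v \<notin> points X \<Longrightarrow> A \<subseteq> points X
    \<Longrightarrow> nat_simple_contractible (link (attach_vertex X v A) v)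
    \<Longrightarrow> nat_simple_contractible (attach_vertex X v A)"
| delete_edge: "nat_simple_contractible X \<Longrightarrow> u \<noteq> w \<Longrightarrow> (u, w) \<in> adj X
    \<Longrightarrow> nat_simple_contractible (edge_link X u w) \<Longrightarrow> nat_simple_contractible (delete_edge X u w)"
| attach_edge: "nat_simple_contractible X \<Longrightarrow> u \<in> points X \<Longrightarrow> w \<in> points X \<Longrightarrow> u \<noteq> w
    \<Longrightarrow> (u, w) \<notin> adj X \<Longrightarrow> nat_simple_contractible (edge_link (attach_edge X u w) u w)
    \<Longrightarrow> nat_simple_contractible (attach_edge X u w)"

definition simple_digitally_contractible :: "'a tolspace \<Rightarrow> bool" where
  "simple_digitally_contractible X \<longleftrightarrow>
     tolerance_space X \<and> (\<exists>N. nat_simple_contractible N \<and> tol_iso N X)"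

definition digital_0_sphere :: "'a tolspace \<Rightarrow> bool" where
  "digital_0_sphere X \<longleftrightarrow>
     (\<exists>a b. a \<noteq> b \<and> X = \<lparr>points = {a, b}, adj = {(a, a), (b, b)}\<rparr>)"

definition digital_1_sphere :: "'a tolspace \<Rightarrow> bool" where
  "digital_1_sphere S \<longleftrightarrow> tolerance_space S \<and> connected_tolspace S \<and>
     (\<forall>v\<in>points S. digital_0_sphere (link S v) \<and>
        simple_digitally_contractible (delete_vertex S v))"

lemma nat_simple_contractible_tolerance_space:
  "nat_simple_contractible X \<Longrightarrow> tolerance_space X"
  by (induction rule: nat_simple_contractible.induct)
    (auto simp: tolerance_space_def one_point_def delete_vertex_def induced_def attach_vertex_def
      delete_edge_def attach_edge_def refl_on_def sym_def)

lemma nat_simple_contractible_nonempty: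
  "nat_simple_contractible X \<Longrightarrow> points X \<noteq> {}"
  by (induction rule: nat_simple_contractible.induct)
    (auto simp: one_point_def delete_vertex_def induced_def attach_vertex_def link_def
      delete_edge_def attach_edge_def neighbors_def tol_iso_def bij_betw_def)

lemma simple_digitally_contractible_nonempty:
  "simple_digitally_contractible X \<Longrightarrow> points X \<noteq> {}"
  using nat_simple_contractible_nonempty
  by (fastforce simp: simple_digitally_contractible_def tol_iso_def bij_betw_def)

lemma nat_simple_contractible_iff:
  "simple_digitally_contractible X \<longleftrightarrow> nat_simple_contractible X"
proof
  show "simple_digitally_contractible X \<Longrightarrow> nat_simple_contractible X"
    by (auto simp: simple_digitally_contractible_def intro: nat_simple_contractible.iso)
next
  have "tol_iso X X"
    unfolding tol_iso_def by (rule exI[of _ id]) auto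
  then show "nat_simple_contractible X \<Longrightarrow> simple_digitally_contractible X"
    by (auto simp: simple_digitally_contractible_def
        intro: nat_simple_contractible_tolerance_space)
qed

end

theory Submission
  imports Defs
begin

text \<open>The obstruction is local, at the unit \<open>s0\<close>, whose two neighbours \<open>a\<close> and \<open>b\<close> in
  a digital circle are not adjacent. In the product, \<open>(a, s0)\<close> and \<open>(s0, b)\<close> are adjacent, since both
  coordinates may move at once. A multiplication with two-sided unit sends these points to \<open>a\<close> and
  \<open>b\<close>, so its continuity would make \<open>a\<close> and \<open>b\<close> adjacent. The topological
  circle, which does carry a multiplication, escapes this argument: there the distance between the
  images of two such points may be twice the size of the move, whereas adjacency is a fixed scale.\<close>

text \<open>The step from \<open>(a, s0)\<close> to \<open>(s0, b)\<close> leaves the unit in one coordinate while returning to it in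
  the other, so the two unit laws together turn it into a step from \<open>a\<close> to \<open>b\<close>.\<close>

lemma neighbors_of_unit_adjacent:
  assumes S: "tolerance_space S"
    and m: "tol_continuous (tol_prod S S) S m"
    and unit: "s0 \<in> points S" "\<forall>x\<in>points S. m (x, s0) = x \<and> x = m (s0, x)"
    and nb: "a \<in> neighbors S s0" "b \<in> neighbors S s0"
  shows "(a, b) \<in> adj S"
proof -
  have pts: "a \<in> points S" "b \<in> points S"
    using nb by (auto simp: neighbors_def)
  have "(a, s0) \<in> adj S" "(s0, b) \<in> adj S"
    using S nb by (auto simp: neighbors_def tolerance_space_def dest: symD)
  then have "((a, s0), (s0, b)) \<in> adj (tol_prod S S)"
    by (simp add: tol_prod_def)
  moreover have "(a, s0) \<in> points (tol_prod S S)" "(s0, b) \<in> points (tol_prod S S)"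
    using pts unit(1) by (simp_all add: tol_prod_def)
  ultimately have "(m (a, s0), m (s0, b)) \<in> adj S"
    using m unfolding tol_continuous_def by blast
  moreover have "m (a, s0) = a" "m (s0, b) = b"
    using bspec[OF unit(2) pts(1)] bspec[OF unit(2) pts(2)] by argo+
  ultimately show ?thesis
    by simp
qed

lemma link_0_sphere_nonadjacent_neighbors:
  assumes "digital_0_sphere (link S v)"
  obtains a b where "a \<in> neighbors S v" "b \<in> neighbors S v" "(a, b) \<notin> adj S"
proof -
  obtain a b where ab: "a \<noteq> b" "link S v = \<lparr>points = {a, b}, adj = {(a, a), (b, b)}\<rparr>"
    using assms unfolding digital_0_sphere_def by blast
  have "points S \<inter> neighbors S v = {a, b}"
    and adj: "adj S \<inter> neighbors S v \<times> neighbors S v = {(a, a), (b, b)}"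
    using ab(2) by (simp_all add: link_def induced_def)
  then have nb: "a \<in> neighbors S v" "b \<in> neighbors S v"
    by blast+
  moreover have "(a, b) \<notin> adj S"
  proof
    assume "(a, b) \<in> adj S"
    with nb have "(a, b) \<in> adj S \<inter> neighbors S v \<times> neighbors S v"
      by blast
    then show False
      unfolding adj using ab(1) by simp
  qed
  ultimately show thesis
    by (rule that)
qed

theorem proposition6p2:
  fixes S :: "'a tolspace"
  assumes "digital_1_sphere S"
  shows "\<not> (\<exists>m s0. tol_continuous (tol_prod S S) S m \<and> s0 \<in> points S \<and>
            (\<forall>x\<in>points S. m (x, s0) = x \<and> x = m (s0, x)))"
proof
  assume "\<exists>m s0. tol_continuous (tol_prod S S) S m \<and> s0 \<in> points S \<and>
            (\<forall>x\<in>points S. m (x, s0) = x \<and> x = m (s0, x))"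
  then obtain m s0 where m: "tol_continuous (tol_prod S S) S m" and s0: "s0 \<in> points S"
    and unit: "\<forall>x\<in>points S. m (x, s0) = x \<and> x = m (s0, x)"
    by blast
  have S: "tolerance_space S" and "digital_0_sphere (link S s0)"
    using assms s0 by (simp_all add: digital_1_sphere_def)
  from this(2) obtain a b where ab: "a \<in> neighbors S s0" "b \<in> neighbors S s0" "(a, b) \<notin> adj S"
    by (elim link_0_sphere_nonadjacent_neighbors)
  show False
    using neighbors_of_unit_adjacent[OF S m s0 unit ab(1,2)] ab(3) by contradiction
qed

end
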